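(* Let $p$ be a prime, $d\in\mathbb{N}$, and $e_1,\dots,e_d\in\mathbb{N}$ with $e_i\le e_{i+1}$ for $1\le i\le d-1$. Let $G=C_{p^{e_1}}\times C_{p^{e_2}}\times\cdots\times C_{p^{e_d}}$ and suppose $p^{e_d}\ge 1+\sum_{i=1}^{d-1}(p^{e_i}-1)$. Then for every $r\in\mathbb{N}$, $$D_r(G)=r\,p^{e_d}+\sum_{i=1}^{d-1}p^{e_i}-d+1.$$
   Context: All groups are finite abelian, written additively; $C_n$ is the cyclic group of order $n$. A sequence over $G$ is a finite multiset of elements of $G$; subsequences are sub-multisets; two subsequences are disjoint if together they form a subsequence (i.e. they use distinct terms). A sequence is zero-sum if the sum of its terms is $0$. For $r\in\mathbb{N}$, the $r$-wise Davenport constant $D_r(G)$ is the least positive integer $k$ such that every sequence over $G$ of length at least $k$ contains $r$ pairwise disjoint nonempty zero-sum subsequences. *)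

theory Defs
  imports
    "HOL-Algebra.FiniteProduct"
    "HOL-Algebra.Product_Groups"
    "HOL-Algebra.Elementary_Groups"
    "HOL-Library.Multiset"
    "HOL-Computational_Algebra.Primes"
begin

text \<open>
  Abelian groups are HOL-Algebra groups, so the group addition is written \<open>\<otimes>\<close>, the neutral
  element \<open>\<one>\<close>, and the multiple \<open>n x\<close> is \<open>x [^] n\<close>. Sequences are finite multisets.
\<close>

definition sequence_over :: "('a, 'b) monoid_scheme \<Rightarrow> 'a multiset \<Rightarrow> bool"
  where "sequence_over G S \<longleftrightarrow> set_mset S \<subseteq> carrier G"

text \<open>
  The sum of the terms of a sequence, counted with multiplicity (for commutative \<open>G\<close>).
  It is grouped by distinct values since \<open>finprod\<close> ranges over a set.
\<close>

definition seq_sum :: "('a, 'b) monoid_scheme \<Rightarrow> 'a multiset \<Rightarrow> 'a"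
  where "seq_sum G S = (\<Otimes>\<^bsub>G\<^esub>x\<in>set_mset S. x [^]\<^bsub>G\<^esub> count S x)"

definition zero_sum :: "('a, 'b) monoid_scheme \<Rightarrow> 'a multiset \<Rightarrow> bool"
  where "zero_sum G S \<longleftrightarrow> seq_sum G S = \<one>\<^bsub>G\<^esub>"

text \<open>
  Disjoint subsequences use distinct terms of \<open>S\<close>, where equal elements at different places are
  different terms. So a family of subsequences is disjoint in \<open>S\<close> iff its multiset sum is
  contained in \<open>S\<close>. Requiring \<open>T i + T j \<subseteq># S\<close> only for each pair \<open>i \<noteq> j\<close>
  would be too weak: three copies of \<open>{#x#}\<close> would be disjoint in \<open>{#x, x#}\<close>.
\<close>

definition has_disjoint_zero_sums :: "('a, 'b) monoid_scheme \<Rightarrow> nat \<Rightarrow> 'a multiset \<Rightarrow> bool"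
  where "has_disjoint_zero_sums G r S \<longleftrightarrow>
    (\<exists>T :: nat \<Rightarrow> 'a multiset.
      (\<forall>i<r. T i \<noteq> {#} \<and> zero_sum G (T i)) \<and> (\<Sum>i<r. T i) \<subseteq># S)"

definition davenport :: "('a, 'b) monoid_scheme \<Rightarrow> nat \<Rightarrow> nat"
  where "davenport G r =
    (LEAST k. k \<ge> 1 \<and>
      (\<forall>S. sequence_over G S \<and> size S \<ge> k \<longrightarrow> has_disjoint_zero_sums G r S))"

end

theory Submission
  imports Defs
begin

text \<open>
  Write \<open>n = p ^ e d\<close> and \<open>D = (\<Sum>i. p ^ e i - 1)\<close>. Olson's bound, that \<open>D + 1\<close> terms force a nonempty
  zero-sum subsequence, is proved by finite differences: the function
  \<open>\<Prod>i. (x i + p ^ e i - 1) choose (p ^ e i - 1)\<close> of the sum \<open>x\<close> of a subsequence has degree \<open>D\<close>, is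
  divisible by \<open>p\<close> unless \<open>x\<close> vanishes in the group, and equals 1 at the empty sequence.
  Applied to the group times \<open>C\<^sub>n\<close>, with every new coordinate equal to 1, Olson's bound shows that
  \<open>D + n\<close> terms force a zero-sum subsequence of length \<open>n\<close> or \<open>2 n\<close>; since \<open>D < 2 n - 1\<close>, the latter
  splits into two, one of them of length at most \<open>n\<close>. Removing such short zero-sum
  subsequences one by one gives the upper bound. For the lower bound, take \<open>r n - 1\<close> copies of
  the last standard generator and \<open>p ^ e i - 1\<close> copies of each other one.
\<close>

section \<open>Finite differences on multisets\<close>

text \<open>
  \<open>degree_less k f\<close> says that all \<open>k\<close>-fold differences of \<open>f\<close> vanish, so \<open>f\<close> is a polynomial of degree
  less than \<open>k\<close>. Multisets, the free commutative monoid, serve as domain, so that a function of the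
  sum of a sequence is treated as a function of the sequence itself.
\<close>

fun degree_less :: "nat \<Rightarrow> ('a multiset \<Rightarrow> int) \<Rightarrow> bool" where
  "degree_less 0 f \<longleftrightarrow> (\<forall>M. f M = 0)"
| "degree_less (Suc k) f \<longleftrightarrow> (\<forall>a. degree_less k (\<lambda>M. f (add_mset a M) - f M))"

lemma degree_less_zero: "degree_less k (\<lambda>M. 0)"
  by (induction k) auto

lemma degree_less_add:
  "degree_less k f \<Longrightarrow> degree_less k g \<Longrightarrow> degree_less k (\<lambda>M. f M + g M)"
proof (induction k arbitrary: f g)
  case (Suc k)
  have "degree_less k (\<lambda>M. (f (add_mset a M) - f M) + (g (add_mset a M) - g M))" for a
    using Suc.prems by (intro Suc.IH) auto
  then show ?case by (simp add: algebra_simps)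
qed simp

lemma degree_less_sum:
  assumes "\<And>i. i \<in> A \<Longrightarrow> degree_less k (f i)"
  shows "degree_less k (\<lambda>M. \<Sum>i\<in>A. f i M)"
  using assms
  by (induction A rule: infinite_finite_induct) (auto simp: degree_less_zero intro: degree_less_add)

lemma degree_less_shift:
  "degree_less k f \<Longrightarrow> degree_less k (\<lambda>M. f (add_mset a M))"
proof (induction k arbitrary: f)
  case (Suc k)
  have "degree_less k (\<lambda>M. f (add_mset b (add_mset a M)) - f (add_mset a M))" for b
    using Suc.IH[of "\<lambda>M. f (add_mset b M) - f M"] Suc.prems by simp
  then show ?case by (simp add: add_mset_commute)
qed simp

text \<open>Discrete Leibniz rule: a difference of the product is \<open>f (add_mset a M)\<close>
  times a difference of \<open>g\<close>, plus a difference of \<open>f\<close> times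
  \<open>g M\<close>. Both products have smaller \<open>j + k\<close>.\<close>

lemma degree_less_mult:
  "degree_less j f \<Longrightarrow> degree_less k g \<Longrightarrow> degree_less (j + k - 1) (\<lambda>M. f M * g M)"
proof (induction "j + k" arbitrary: j k f g rule: less_induct)
  case less
  show ?case
  proof (cases "j = 0 \<or> k = 0")
    case True
    then have "(\<lambda>M. f M * g M) = (\<lambda>M. 0)" using less.prems by auto
    then show ?thesis by (simp add: degree_less_zero)
  next
    case False
    then obtain j' k' where jk: "j = Suc j'" "k = Suc k'" by (metis not0_implies_Suc)
    have "degree_less (j' + k') (\<lambda>M. f (add_mset a M) * (g (add_mset a M) - g M)
        + (f (add_mset a M) - f M) * g M)" for a
    proof (intro degree_less_add)
      show "degree_less (j' + k') (\<lambda>M. f (add_mset a M) * (g (add_mset a M) - g M))"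
        using less.hyps[of j k' "\<lambda>M. f (add_mset a M)" "\<lambda>M. g (add_mset a M) - g M"]
          degree_less_shift[of j f a] less.prems jk by simp
      show "degree_less (j' + k') (\<lambda>M. (f (add_mset a M) - f M) * g M)"
        using less.hyps[of j' k "\<lambda>M. f (add_mset a M) - f M" g] less.prems jk by simp
    qed
    then show ?thesis by (simp add: jk algebra_simps)
  qed
qed

lemma degree_less_prod:
  assumes "finite A" "\<And>i. i \<in> A \<Longrightarrow> degree_less (Suc (k i)) (f i)"
  shows "degree_less (Suc (\<Sum>i\<in>A. k i)) (\<lambda>M. \<Prod>i\<in>A. f i M)"
  using assms
proof (induction A rule: finite_induct)
  case (insert x A)
  then show ?case
    using degree_less_mult[of "Suc (k x)" "f x" "Suc (\<Sum>i\<in>A. k i)"] by simp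
qed simp

lemma choose_diff_eq_sum:
  "int ((m + a) choose Suc k) - int (m choose Suc k) = (\<Sum>t<a. int ((m + t) choose k))"
  by (induction a) auto

text \<open>By the telescoped Pascal rule, a difference is a sum of \<open>w a\<close> binomials
  with lower index \<open>k\<close> and shifts \<open>c + t\<close>. Hence the induction must leave
  \<open>c\<close> arbitrary.\<close>

lemma degree_less_choose:
  "degree_less (Suc k) (\<lambda>M. int ((sum_mset (image_mset w M) + c) choose k))"
proof (induction k arbitrary: c)
  case (Suc k)
  have "degree_less (Suc k) (\<lambda>M. int ((sum_mset (image_mset w (add_mset a M)) + c) choose Suc k)
      - int ((sum_mset (image_mset w M) + c) choose Suc k))" for a
  proof -
    have "(\<lambda>M. int ((sum_mset (image_mset w (add_mset a M)) + c) choose Suc k)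
        - int ((sum_mset (image_mset w M) + c) choose Suc k))
      = (\<lambda>M. \<Sum>t<w a. int ((sum_mset (image_mset w M) + (c + t)) choose k))"
      using choose_diff_eq_sum[of "sum_mset (image_mset w M) + c" "w a" k for M]
      by (simp add: ac_simps)
    then show ?thesis using Suc.IH by (simp only: degree_less_sum)
  qed
  then show ?case using degree_less.simps(2) by blast
qed simp

text \<open>A vanishing \<open>k\<close>-fold difference along terms of \<open>S\<close> is an
  alternating sum of \<open>f\<close> over subsequences, so divisibility at the nonempty ones passes
  to the empty one. The induction takes one difference at a time.\<close>

lemma degree_less_dvd_empty:
  assumes "degree_less k f" "k \<le> size S"
    and "\<And>T. T \<subseteq># S \<Longrightarrow> T \<noteq> {#} \<Longrightarrow> q dvd f T"
  shows "q dvd f {#}"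
  using assms
proof (induction k arbitrary: f S)
  case (Suc k)
  then obtain a S' where S: "S = add_mset a S'"
    by (metis Suc_le_D size_eq_Suc_imp_eq_union)
  have "q dvd f (add_mset a T) - f T" if "T \<subseteq># S'" "T \<noteq> {#}" for T
  proof -
    have "T \<subseteq># S"
      using that(1) S by (metis add_mset_add_single mset_subset_eq_add_left subset_mset.order_trans)
    then show ?thesis using that S by (intro dvd_diff Suc.prems(3)) auto
  qed
  then have "q dvd f {#a#} - f {#}"
    using Suc.IH[of "\<lambda>M. f (add_mset a M) - f M" S'] Suc.prems(1,2) S by simp
  moreover have "q dvd f {#a#}" using Suc.prems(3) S by simp
  ultimately show ?case by (simp add: dvd_diff_right_iff)
qed simp

section \<open>Olson's zero-sum theorem\<close>

text \<open>With \<open>k = p ^ c - 1\<close>, the integer \<open>x\<close> times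
  \<open>(x + k) choose k\<close> equals \<open>p ^ c\<close> times
  \<open>(x + k) choose Suc k\<close>. A binomial prime to \<open>p\<close> would thus force
  \<open>p ^ c\<close> to divide \<open>x\<close>.\<close>

lemma prime_dvd_choose_if_not_dvd:
  fixes p :: nat
  assumes "prime p" "\<not> p ^ c dvd x"
  shows "p dvd (x + (p ^ c - 1)) choose (p ^ c - 1)"
proof (rule ccontr)
  let ?C = "(x + (p ^ c - 1)) choose (p ^ c - 1)"
  assume "\<not> p dvd ?C"
  then have "coprime (p ^ c) ?C"
    using assms(1) by (simp add: prime_imp_coprime)
  moreover have "p ^ c dvd x * ?C"
  proof -
    obtain k where k: "p ^ c = Suc k"
      using assms(1) by (metis not0_implies_Suc power_not_zero not_prime_0)
    obtain b where "x = Suc b"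
      using assms(2) by (metis dvd_0_right not0_implies_Suc)
    then have "p ^ c * ((x + k) choose Suc k) = x * ?C"
      using Suc_times_binomial_add[of k b] k by (simp add: ac_simps)
    then show ?thesis by (metis dvd_triv_left)
  qed
  ultimately show False
    using assms(2) by (simp add: coprime_dvd_mult_left_iff)
qed

text \<open>The group enters only through natural-number weights \<open>w i\<close>, representing
  coordinates, so that coordinates can be added without changing the type of the terms.\<close>

theorem olson_zero_sum:
  fixes w :: "'i \<Rightarrow> 'a \<Rightarrow> nat"
  assumes p: "prime p" and I: "finite I" and S: "(\<Sum>i\<in>I. p ^ e i - 1) < size S"
  shows "\<exists>T. T \<subseteq># S \<and> T \<noteq> {#} \<and> (\<forall>i\<in>I. p ^ e i dvd sum_mset (image_mset (w i) T))"
proof (rule ccontr)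
  assume *: "\<not> ?thesis"
  let ?f = "\<lambda>M. \<Prod>i\<in>I. int ((sum_mset (image_mset (w i) M) + (p ^ e i - 1)) choose (p ^ e i - 1))"
  have deg: "degree_less (Suc (\<Sum>i\<in>I. p ^ e i - 1)) ?f"
    using I by (intro degree_less_prod degree_less_choose)
  have dvd: "int p dvd ?f T" if T: "T \<subseteq># S" "T \<noteq> {#}" for T
  proof -
    obtain i where "i \<in> I" "\<not> p ^ e i dvd sum_mset (image_mset (w i) T)"
      using * T by blast
    then show ?thesis
      using prime_dvd_choose_if_not_dvd[OF p] I by (intro dvd_prodI[THEN dvd_trans[rotated]]) auto
  qed
  have "int p dvd ?f {#}"
    using degree_less_dvd_empty[OF deg Suc_leI[OF S] dvd] .
  then show False using p by simp
qed

section \<open>Short zero-sum subsequences and the upper bound\<close>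

lemma short_zero_sum:
  fixes w :: "'i \<Rightarrow> 'a \<Rightarrow> nat"
  assumes p: "prime p" and I: "finite I"
    and D: "(\<Sum>i\<in>I. p ^ e i - 1) + 2 \<le> 2 * p ^ c"
    and S: "(\<Sum>i\<in>I. p ^ e i - 1) + p ^ c \<le> size S"
  shows "\<exists>T. T \<subseteq># S \<and> T \<noteq> {#} \<and> size T \<le> p ^ c \<and>
    (\<forall>i\<in>I. p ^ e i dvd sum_mset (image_mset (w i) T))"
proof -
  define n where "n = p ^ c"
  define D where "D = (\<Sum>i\<in>I. p ^ e i - 1)"
  have n: "n > 0" using p by (simp add: n_def prime_gt_0_nat)
  obtain xs where xs: "mset xs = S" using ex_mset by blast
  \<comment> \<open>Keeping exactly \<open>D + n\<close> terms, at most \<open>3 * n - 2\<close>,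
    excludes subsequences of length \<open>3 * n\<close> or more.\<close>
  define S' where "S' = mset (take (D + n) xs)"
  have "S' \<subseteq># S"
    using xs unfolding S'_def by (metis append_take_drop_id mset_append mset_subset_eq_add_left)
  moreover have "size S' = D + n"
    using S by (simp add: S'_def D_def n_def flip: xs)
  ultimately have S': "S' \<subseteq># S" "size S' = D + n" by blast+
  \<comment> \<open>\<open>None\<close> indexes the additional coordinate modulo \<open>n\<close>;
    its weight is constantly 1, so its coordinate sum is the length.\<close>
  let ?J = "insert None (Some ` I)"
  have "(\<Sum>i\<in>?J. p ^ case_option c e i - 1) = n - 1 + D"
    using I by (simp add: sum.reindex n_def D_def)
  then have "(\<Sum>i\<in>?J. p ^ case_option c e i - 1) < size S'"
    using S' n by simp
  from olson_zero_sum[OF p _ this, of "case_option (\<lambda>_. 1) w"] I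
  obtain T where T: "T \<subseteq># S'" "T \<noteq> {#}" "n dvd size T"
    "\<forall>i\<in>I. p ^ e i dvd sum_mset (image_mset (w i) T)"
    by (auto simp: n_def)
  obtain m where m: "size T = n * m" using T(3) by blast
  have "size T < n * 3" using size_mset_mono[OF T(1)] S' assms(3) n by (simp add: n_def D_def)
  then have "m < 3" using m by simp
  moreover have "m \<noteq> 0" using T(2) m by (metis mult_0_right size_eq_0_iff_empty)
  ultimately consider "m = 1" | "m = 2" by linarith
  then consider "size T = n" | "size T = 2 * n" using m by (cases; simp)
  then show ?thesis
  proof cases
    case 1
    moreover have "T \<subseteq># S" using T(1) S'(1) by (rule subset_mset.order_trans)
    ultimately show ?thesis using T n_def by auto
  next
    case 2
    \<comment> \<open>The remaining \<open>2 * n - 1\<close> terms still exceed \<open>D\<close>,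
      and setting \<open>a\<close> aside keeps the complement \<open>V\<close> of \<open>U\<close>
      nonempty.\<close>
    obtain a T' where a: "T = add_mset a T'" using T(2) by (metis multiset_cases)
    then have "D < size T'" using 2 assms(3) by (simp add: n_def D_def)
    from olson_zero_sum[OF p I this[unfolded D_def], of w]
    obtain U where U: "U \<subseteq># T'" "U \<noteq> {#}" "\<forall>i\<in>I. p ^ e i dvd sum_mset (image_mset (w i) U)"
      by blast
    have UT: "U \<subseteq># T"
      using U(1) a by (metis add_mset_add_single mset_subset_eq_add_left subset_mset.order_trans)
    define V where "V = T - U"
    have TUV: "T = U + V" using UT by (simp add: V_def)
    have "size U + size V = Suc (size T')" using TUV a by (metis size_add_mset size_union)
    then have "V \<noteq> {#}" using size_mset_mono[OF U(1)] by auto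
    moreover have "p ^ e i dvd sum_mset (image_mset (w i) V)" if "i \<in> I" for i
      using that T(4) U(3) TUV by (metis dvd_add_right_iff image_mset_union sum_mset.union)
    moreover have "size U \<le> n \<or> size V \<le> n" using 2 TUV by auto
    moreover have "V \<subseteq># S" "U \<subseteq># S" using TUV T(1) S'(1)
      by (metis mset_subset_eq_add_right mset_subset_eq_add_left subset_mset.order_trans)+
    ultimately show ?thesis using U unfolding n_def by blast
  qed
qed

text \<open>Each short subsequence costs at most \<open>p ^ c\<close> terms, and the last one needs
  only Olson's bound; hence \<open>r\<close> such costs yield \<open>Suc r\<close>
  subsequences.\<close>

lemma disjoint_zero_sums:
  fixes w :: "'i \<Rightarrow> 'a \<Rightarrow> nat"
  assumes p: "prime p" and I: "finite I"
    and D: "(\<Sum>i\<in>I. p ^ e i - 1) + 2 \<le> 2 * p ^ c"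
    and S: "r * p ^ c + (\<Sum>i\<in>I. p ^ e i - 1) < size S"
  shows "\<exists>T. (\<forall>j<Suc r. T j \<noteq> {#} \<and> (\<forall>i\<in>I. p ^ e i dvd sum_mset (image_mset (w i) (T j))))
    \<and> (\<Sum>j<Suc r. T j) \<subseteq># S"
  using S
proof (induction r arbitrary: S)
  case 0
  then obtain T where "T \<subseteq># S" "T \<noteq> {#}" "\<forall>i\<in>I. p ^ e i dvd sum_mset (image_mset (w i) T)"
    using olson_zero_sum[OF p I, of e S w] by auto
  then show ?case by (intro exI[of _ "\<lambda>_. T"]) simp
next
  case (Suc r)
  then obtain U where U: "U \<subseteq># S" "U \<noteq> {#}" "size U \<le> p ^ c"
    "\<forall>i\<in>I. p ^ e i dvd sum_mset (image_mset (w i) U)"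
    using short_zero_sum[OF p I D, of S w] by auto
  have "r * p ^ c + (\<Sum>i\<in>I. p ^ e i - 1) < size (S - U)"
    using Suc.prems U(1,3) by (simp add: size_Diff_submset)
  from Suc.IH[OF this] obtain T where T:
    "\<forall>j<Suc r. T j \<noteq> {#} \<and> (\<forall>i\<in>I. p ^ e i dvd sum_mset (image_mset (w i) (T j)))"
    "(\<Sum>j<Suc r. T j) \<subseteq># S - U" by blast
  have "(\<Sum>j<Suc r. (T(Suc r := U)) j) = (\<Sum>j<Suc r. T j)"
    by (intro sum.cong) auto
  then have "(\<Sum>j<Suc (Suc r). (T(Suc r := U)) j) = (\<Sum>j<Suc r. T j) + U"
    by (subst sum.lessThan_Suc) simp
  also have "\<dots> \<subseteq># S"
    using T(2) U(1) by (simp add: subset_mset.le_diff_conv2)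
  finally have "(\<Sum>j<Suc (Suc r). (T(Suc r := U)) j) \<subseteq># S" .
  moreover have "\<forall>j<Suc (Suc r). (T(Suc r := U)) j \<noteq> {#} \<and>
      (\<forall>i\<in>I. p ^ e i dvd sum_mset (image_mset (w i) ((T(Suc r := U)) j)))"
    using T(1) U by (auto simp: less_Suc_eq)
  ultimately show ?case by blast
qed

section \<open>Zero sums in products of cyclic groups\<close>

context comm_group
begin

lemma seq_sum_empty: "seq_sum G {#} = \<one>"
  by (simp add: seq_sum_def)

lemma seq_sum_closed: "sequence_over G S \<Longrightarrow> seq_sum G S \<in> carrier G"
  unfolding seq_sum_def sequence_over_def by (intro finprod_closed) auto

text \<open>The factor belonging to the value \<open>a\<close> is split off, with exponent 0 if
  \<open>a\<close> is absent from \<open>S\<close>. This recursion permits induction on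
  sequences.\<close>

lemma seq_sum_add_mset:
  assumes "sequence_over G (add_mset a S)"
  shows "seq_sum G (add_mset a S) = a \<otimes> seq_sum G S"
proof -
  let ?A = "set_mset S - {a}"
  have C: "a \<in> carrier G" "set_mset S \<subseteq> carrier G" using assms by (auto simp: sequence_over_def)
  let ?R = "\<Otimes>x\<in>?A. x [^] count S x"
  have R: "?R \<in> carrier G" using C by (intro finprod_closed) auto
  have cong: "(\<Otimes>x\<in>?A. x [^] count (add_mset a S) x) = ?R"
    using C by (intro finprod_cong') auto
  have "seq_sum G (add_mset a S) = (\<Otimes>x\<in>insert a ?A. x [^] count (add_mset a S) x)"
    by (simp add: seq_sum_def)
  also have "\<dots> = a [^] Suc (count S a) \<otimes> ?R"
    using C by (subst finprod_insert) (auto simp: cong[simplified])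
  also have "\<dots> = a \<otimes> (a [^] count S a \<otimes> ?R)"
    using C R by (simp add: m_assoc m_lcomm)
  also have "a [^] count S a \<otimes> ?R = seq_sum G S"
  proof (cases "a \<in># S")
    case True
    then have "set_mset S = insert a ?A" by auto
    then have "seq_sum G S = (\<Otimes>x\<in>insert a ?A. x [^] count S x)" by (simp add: seq_sum_def)
    also have "\<dots> = a [^] count S a \<otimes> ?R"
      using C by (subst finprod_insert) auto
    finally show ?thesis ..
  next
    case False
    then show ?thesis using C R by (simp add: seq_sum_def not_in_iff)
  qed
  finally show ?thesis .
qed

end

lemma carrier_product_integer_mod_group:
  assumes "\<And>i. i \<in> I \<Longrightarrow> q i > 0"
  shows "carrier (product_group I (\<lambda>i. integer_mod_group (q i))) = (\<Pi>\<^sub>E i\<in>I. {0..<int (q i)})"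
proof -
  have "carrier (integer_mod_group (q i)) = {0..<int (q i)}" if "i \<in> I" for i
    using assms[OF that] by (simp add: carrier_integer_mod_group)
  then show ?thesis by (simp cong: PiE_cong)
qed

text \<open>This links the group to the weights. Coordinates are residues in
  \<open>{0..<int (q i)}\<close>, so \<open>nat\<close> loses nothing, and addition is integer
  addition modulo \<open>q i\<close>.\<close>

lemma zero_sum_product_group_iff:
  fixes q :: "'i \<Rightarrow> nat" and I :: "'i set"
  defines "G \<equiv> product_group I (\<lambda>i. integer_mod_group (q i))"
  assumes q: "\<And>i. i \<in> I \<Longrightarrow> q i > 0" and S: "sequence_over G S"
  shows "zero_sum G S \<longleftrightarrow> (\<forall>i\<in>I. q i dvd (\<Sum>x\<in>#S. nat (x i)))"
proof -
  interpret G: comm_group G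
    unfolding G_def
    by (intro group.group_comm_groupI) (auto simp: add.commute restrict_def)
  have car: "carrier G = (\<Pi>\<^sub>E i\<in>I. {0..<int (q i)})"
    unfolding G_def using q by (rule carrier_product_integer_mod_group)
  have comp: "seq_sum G S i = int (\<Sum>x\<in>#S. nat (x i)) mod int (q i)" if i: "i \<in> I" for i
    using S
  proof (induction S)
    case empty
    then show ?case using i by (simp add: G.seq_sum_empty) (simp add: G_def)
  next
    case (add a S)
    then have "a \<in> carrier G" "sequence_over G S" by (auto simp: sequence_over_def)
    then have "0 \<le> a i" using car i by (auto dest: PiE_mem)
    then show ?case
      using add i by (simp add: G.seq_sum_add_mset \<open>sequence_over G S\<close>)
        (simp add: G_def mult_integer_mod_group mod_simps)
  qed
  have "seq_sum G S \<in> carrier G" using S by (rule G.seq_sum_closed)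
  then have "zero_sum G S \<longleftrightarrow> (\<forall>i\<in>I. seq_sum G S i = 0)"
    unfolding zero_sum_def car by (auto simp: G_def fun_eq_iff PiE_def extensional_def)
  also have "\<dots> \<longleftrightarrow> (\<forall>i\<in>I. q i dvd (\<Sum>x\<in>#S. nat (x i)))"
    by (intro ball_cong) (simp_all only: comp mod_eq_0_iff_dvd of_nat_dvd_iff)
  finally show ?thesis .
qed

section \<open>The lower bound\<close>

text \<open>For \<open>i \<noteq> l\<close> there are too few copies of the generator
  \<open>b i\<close> to sum to zero, so every nonempty zero-sum subsequence uses at least
  \<open>q l\<close> copies of \<open>b l\<close>, and \<open>r\<close> disjoint ones would need
  \<open>r * q l\<close>.\<close>

lemma exists_few_zero_sums:
  fixes q :: "'i \<Rightarrow> nat" and I :: "'i set"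
  defines "G \<equiv> product_group I (\<lambda>i. integer_mod_group (q i))"
  assumes I: "finite I" "l \<in> I" and q: "\<And>i. i \<in> I \<Longrightarrow> q i \<ge> 2" and r: "r \<ge> 1"
  shows "\<exists>S. sequence_over G S \<and> size S = r * q l - 1 + (\<Sum>i\<in>I - {l}. q i - 1)
    \<and> \<not> has_disjoint_zero_sums G r S"
proof -
  define b :: "'i \<Rightarrow> 'i \<Rightarrow> int" where "b i = (\<lambda>j\<in>I. if j = i then 1 else 0)" for i
  define m where "m i = (if i = l then r * q l - 1 else q i - 1)" for i
  define S where "S = (\<Sum>i\<in>I. replicate_mset (m i) (b i))"
  have car: "carrier G = (\<Pi>\<^sub>E i\<in>I. {0..<int (q i)})"
    unfolding G_def using q by (intro carrier_product_integer_mod_group) fastforce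
  have mem: "\<exists>i\<in>I. x = b i" if "x \<in># S" for x
    using that I unfolding S_def by (auto simp: set_mset_sum split: if_splits)
  have over: "sequence_over G T" if "T \<subseteq># S" for T
    using mem mset_subset_eqD[OF that] q unfolding sequence_over_def car
    by (fastforce simp: b_def)
  have coord: "(\<Sum>x\<in>#S. nat (x j)) = m j" if j: "j \<in> I" for j
  proof -
    have "(\<Sum>x\<in>#S. nat (x j)) = (\<Sum>i\<in>I. m i * nat (b i j))"
      unfolding S_def using I(1) by (induction I rule: finite_induct) auto
    also have "\<dots> = (\<Sum>i\<in>I. if i = j then m i else 0)"
      using j by (intro sum.cong) (auto simp: b_def)
    finally show ?thesis using I(1) j by simp
  qed
  have zs: "q l \<le> (\<Sum>x\<in>#T. nat (x l))" if T: "T \<subseteq># S" "T \<noteq> {#}" "zero_sum G T" for T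
  proof -
    have dvd: "q i dvd (\<Sum>x\<in>#T. nat (x i))" if "i \<in> I" for i
      using zero_sum_product_group_iff[of I q T] over[OF T(1)] T(3) that q
      unfolding G_def by fastforce
    obtain x where x: "x \<in># T" using T(2) by blast
    then obtain j where j: "j \<in> I" "x = b j" using mem T(1) mset_subset_eqD by metis
    obtain T' where T': "T = add_mset x T'" using x by (metis insert_DiffM)
    have "(\<Sum>x\<in>#T. nat (x j)) > 0" using j T' by (simp add: b_def)
    then have le: "q j \<le> (\<Sum>x\<in>#T. nat (x j))" using dvd[OF j(1)] by (simp add: dvd_imp_le)
    obtain U where "S = T + U" using T(1) by (metis subset_mset.le_iff_add)
    then have "(\<Sum>x\<in>#T. nat (x j)) \<le> m j" using coord[OF j(1)] by simp
    then have "q j \<le> m j" using le by simp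
    then have "j = l" using q[OF j(1)] by (auto simp: m_def split: if_splits)
    then show ?thesis using le by simp
  qed
  have "\<not> has_disjoint_zero_sums G r S"
  proof
    assume "has_disjoint_zero_sums G r S"
    then obtain T where T: "\<And>k. k < r \<Longrightarrow> T k \<noteq> {#} \<and> zero_sum G (T k)" "(\<Sum>k<r. T k) \<subseteq># S"
      unfolding has_disjoint_zero_sums_def by blast
    have sub: "T k \<subseteq># S" if "k < r" for k
    proof -
      have "(\<Sum>k<r. T k) = T k + (\<Sum>k\<in>{..<r} - {k}. T k)"
        using that by (simp add: sum.remove)
      then show ?thesis using T(2) by (metis mset_subset_eq_add_left subset_mset.order_trans)
    qed
    have "r * q l \<le> (\<Sum>k<r. \<Sum>x\<in>#T k. nat (x l))"
      using sum_mono[of "{..<r}" "\<lambda>_. q l" "\<lambda>k. \<Sum>x\<in>#T k. nat (x l)"] zs sub T(1) by simp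
    also have "\<dots> = (\<Sum>x\<in>#(\<Sum>k<r. T k). nat (x l))"
      by (induction r) auto
    also have "\<dots> \<le> (\<Sum>x\<in>#S. nat (x l))"
      using T(2) by (metis image_mset_union le_add1 subset_mset.le_iff_add sum_mset.union)
    also have "\<dots> = r * q l - 1" using coord[OF I(2)] by (simp add: m_def)
    \<comment> \<open>The product \<open>r * q l\<close> is positive, so the truncated subtraction
      really lowers it.\<close>
    finally show False using mult_le_mono[OF r q[OF I(2)]] by linarith
  qed
  moreover have "size S = r * q l - 1 + (\<Sum>i\<in>I - {l}. q i - 1)"
    unfolding S_def using I by (simp add: size_multiset_sum sum.remove[of I l] m_def)
  ultimately show ?thesis using over by blast
qed

section \<open>The value of the Davenport constant\<close>

theorem theorem3:
  fixes p d r :: nat and e :: "nat \<Rightarrow> nat"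
  assumes "prime p"
    and "d \<ge> 1"
    and "\<forall>i\<in>{1..d}. e i \<ge> 1"
    and "\<forall>i\<in>{1..d - 1}. e i \<le> e (i + 1)"
    and "p ^ e d \<ge> 1 + (\<Sum>i = 1..d - 1. (p ^ e i - 1))"
    and "r \<ge> 1"
  shows "int (davenport (product_group {1..d} (\<lambda>i. integer_mod_group (p ^ e i))) r)
    = int r * int p ^ e d + (\<Sum>i = 1..d - 1. int p ^ e i) - int d + 1"
proof -
  let ?G = "product_group {1..d} (\<lambda>i. integer_mod_group (p ^ e i))"
  define s where "s = (\<Sum>i = 1..d - 1. p ^ e i - 1)"
  have d: "{1..d} - {d} = {1..d - 1}" by auto
  have p2: "p ^ e i \<ge> 2" if "i \<in> {1..d}" for i
    using that assms(1,3) prime_ge_2_nat[of p] self_le_power[of p "e i"]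
    by (metis One_nat_def Suc_le_eq le_trans one_le_numeral)
  have pd: "p ^ e d \<ge> 2" using p2 assms(2) by simp
  have D: "(\<Sum>i\<in>{1..d}. p ^ e i - 1) = p ^ e d - 1 + s"
    using assms(2) by (simp add: sum.remove[of _ d] d[simplified] s_def)
  have "davenport ?G r = r * p ^ e d + s"
    unfolding davenport_def
  proof (rule Least_equality, intro conjI allI impI)
    show "1 \<le> r * p ^ e d + s" using mult_le_mono[OF assms(6) pd] by simp
  next
    fix S assume S: "sequence_over ?G S \<and> r * p ^ e d + s \<le> size S"
    \<comment> \<open>The length \<open>r * p ^ e d + s\<close> is one more than
      \<open>r' * p ^ e d\<close> plus Olson's sum, which is \<open>p ^ e d - 1 + s\<close>.\<close>
    obtain r' where r': "r = Suc r'" using assms(6) by (metis Suc_le_D One_nat_def)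
    have "r' * p ^ e d + (\<Sum>i\<in>{1..d}. p ^ e i - 1) < size S"
      using S pd unfolding D r' mult_Suc by linarith
    moreover have "(\<Sum>i\<in>{1..d}. p ^ e i - 1) + 2 \<le> 2 * p ^ e d"
      unfolding D using assms(5) pd by (simp add: s_def)
    ultimately obtain T where T:
      "\<forall>j<r. T j \<noteq> {#} \<and> (\<forall>i\<in>{1..d}. p ^ e i dvd (\<Sum>x\<in>#T j. nat (x i)))"
      "(\<Sum>j<r. T j) \<subseteq># S"
      using disjoint_zero_sums[OF assms(1), of "{1..d}" e "e d" r' S "\<lambda>i x. nat (x i)"] r'
      by auto
    have "zero_sum ?G (T j)" if "j < r" for j
    proof -
      have "T j \<subseteq># (\<Sum>j<r. T j)" using that by (simp add: sum.remove[of _ j])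
      then have "sequence_over ?G (T j)"
        using S T(2) unfolding sequence_over_def
        by (meson set_mset_mono subset_mset.order_trans subset_trans)
      moreover have "p ^ e i > 0" for i using assms(1) by (simp add: prime_gt_0_nat)
      ultimately show ?thesis
        using zero_sum_product_group_iff[of "{1..d}" "\<lambda>i. p ^ e i" "T j"] T(1) that by blast
    qed
    then show "has_disjoint_zero_sums ?G r S"
      using T unfolding has_disjoint_zero_sums_def by blast
  next
    fix k assume k: "1 \<le> k \<and> (\<forall>S. sequence_over ?G S \<and> k \<le> size S \<longrightarrow> has_disjoint_zero_sums ?G r S)"
    obtain S where S: "sequence_over ?G S" "size S = r * p ^ e d - 1 + s"
      "\<not> has_disjoint_zero_sums ?G r S"
      using exists_few_zero_sums[of "{1..d}" d "\<lambda>i. p ^ e i" r] assms(2,6) p2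
      unfolding d s_def by auto
    then have "size S < k" using k by (meson not_le)
    then show "r * p ^ e d + s \<le> k" using S(2) by linarith
  qed
  \<comment> \<open>The sum has \<open>d - 1\<close> summands, each lowered by 1.\<close>
  moreover have "int s = (\<Sum>i = 1..d - 1. int p ^ e i) - (int d - 1)"
    using assms(1,2) by (simp add: s_def of_nat_diff sum_subtractf prime_gt_0_nat Suc_le_eq)
  ultimately show ?thesis by simp
qed

end
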